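(* Let $G_{\mathbb C}$ be a connected complex semisimple Lie group, $G$ a connected closed subgroup of $G_{\mathbb C}$ whose Lie algebra $\mathfrak g$ is a real form of $\mathfrak g_{\mathbb C}$, $T$ a non-zero elliptic element of $\mathfrak g$, $L=C_G(T)$, and let $Q^-$ be as in the context. Let $\mathsf V$ be a finite-dimensional complex vector space and $\rho:Q^-\to GL(\mathsf V)$ a holomorphic homomorphism. Let $\mathcal V_{G/L}$ be the complex vector space of holomorphic maps $\psi:GQ^-\to\mathsf V$ such that $\psi(xq)=\rho(q)^{-1}(\psi(x))$ for all $(x,q)\in GQ^-\times Q^-$, equipped with the Fréchet metric $d$ of the context (so that it is a Fréchet space over $\mathbb C$). Define $\varrho:G\to GL(\mathcal V_{G/L})$ by $$(\varrho(g)\psi)(x)=\psi(g^{-1}x)\qquad(g\in G,\ \psi\in\mathcal V_{G/L},\ x\in GQ^-).$$ Then $\varrho$ is a continuous representation of the Lie group $G$ on the Fréchet space $\mathcal V_{G/L}$; that is, the map $G\times\mathcal V_{G/L}\to\mathcal V_{G/L}$, $(g,\psi)\mapsto\varrho(g)\psi$, is continuous.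
   Context: An element $T$ of a real semisimple Lie algebra $\mathfrak g$ is elliptic if $\operatorname{ad}T:\mathfrak g\to\mathfrak g$ is semisimple and all its eigenvalues lie in $i\mathbb R$. $C_G(T)=\{g\in G: \operatorname{Ad}g(T)=T\}$. For $\lambda\in\mathbb R$, $\mathfrak g^{\lambda}=\{X\in\mathfrak g_{\mathbb C}: \operatorname{ad}T(X)=i\lambda X\}$, and $Q^-=\{q\in G_{\mathbb C}:\operatorname{Ad}q(\bigoplus_{\nu\ge0}\mathfrak g^{-\nu})\subset\bigoplus_{\nu\ge0}\mathfrak g^{-\nu}\}$, a closed complex subgroup of $G_{\mathbb C}$; $GQ^-$ is an open connected subset of $G_{\mathbb C}$. Fréchet metric: fix a norm $\|\cdot\|$ on $\mathsf V$ and non-empty open sets $O_n\subset GQ^-$ $(n\in\mathbb N)$ with $GQ^-=\bigcup_nO_n$ and each closure $E_n=\overline{O_n}$ (in $GQ^-$) compact; put $d_{E_n}(\psi_1,\psi_2)=\sup_{y\in E_n}\|\psi_1(y)-\psi_2(y)\|$ and $d(\psi_1,\psi_2)=\sum_{n\ge1}2^{-n}\frac{d_{E_n}(\psi_1,\psi_2)}{1+d_{E_n}(\psi_1,\psi_2)}$. The topology of $d$ is that of uniform convergence on compact sets. $GL(\mathcal V)$ denotes the group of invertible linear maps of $\mathcal V$. *)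

theory Defs
  imports
    "HOL-Analysis.Analysis"
    "HOL-Library.Function_Algebras"
    "HOL-Algebra.Coset"
    "HOL-Algebra.Bij"
begin

section \<open>Complex normed spaces and complex differentiability\<close>

text \<open>The distribution has no class of complex vector spaces; complex scalar multiplication
  is passed as an explicit operation \<open>s\<close>.\<close>

locale fin_dim_complex_normed_space = vector_space s
  for s :: "complex \<Rightarrow> 'v::real_normed_vector \<Rightarrow> 'v" +
  assumes scale_of_real: "s (of_real r) v = r *\<^sub>R v"
    and norm_scale: "norm (s c v) = cmod c * norm v"
    and finite_dim: "\<exists>B. finite B \<and> module.span s B = UNIV"

definition complex_differentiable_on ::
  "(complex \<Rightarrow> 'u \<Rightarrow> 'u) \<Rightarrow> (complex \<Rightarrow> 'v \<Rightarrow> 'v) \<Rightarrow>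
   ('u::real_normed_vector \<Rightarrow> 'v::real_normed_vector) \<Rightarrow> 'u set \<Rightarrow> bool" where
  "complex_differentiable_on s s' f S \<longleftrightarrow>
     (\<forall>z\<in>S. \<exists>D. (f has_derivative D) (at z within S) \<and> (\<forall>c v. D (s c v) = s' c (D v)))"

section \<open>Complex manifolds\<close>

text \<open>A chart is a pair of a domain and a coordinate map; the values of the coordinate map
  outside the domain are irrelevant.\<close>

type_synonym ('a, 'm) chart = "'a set \<times> ('a \<Rightarrow> complex ^ 'm)"

definition chart_inv :: "('a, 'm) chart \<Rightarrow> complex ^ 'm \<Rightarrow> 'a" where
  "chart_inv c = inv_into (fst c) (snd c)"

definition is_chart :: "'a topology \<Rightarrow> ('a, 'm::finite) chart \<Rightarrow> bool" where
  "is_chart X c \<longleftrightarrow> openin X (fst c) \<and> open (snd c ` fst c) \<and>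
     homeomorphic_map (subtopology X (fst c)) (top_of_set (snd c ` fst c)) (snd c)"

definition holomorphically_compatible ::
  "('a, 'm::finite) chart \<Rightarrow> ('a, 'm) chart \<Rightarrow> bool" where
  "holomorphically_compatible c c' \<longleftrightarrow>
     complex_differentiable_on (*s) (*s) (snd c' \<circ> chart_inv c) (snd c ` (fst c \<inter> fst c')) \<and>
     complex_differentiable_on (*s) (*s) (snd c \<circ> chart_inv c') (snd c' ` (fst c \<inter> fst c'))"

text \<open>The complex structure is a maximal holomorphic atlas.\<close>

definition complex_manifold :: "'a topology \<Rightarrow> ('a, 'm::finite) chart set \<Rightarrow> bool" where
  "complex_manifold X A \<longleftrightarrow>
     Hausdorff_space X \<and>
     (\<exists>\<B>. countable \<B> \<and> (\<forall>B\<in>\<B>. openin X B) \<and>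
        (\<forall>U. openin X U \<longrightarrow> (\<exists>\<U>\<subseteq>\<B>. U = \<Union>\<U>))) \<and>
     (\<forall>c\<in>A. is_chart X c) \<and>
     (\<Union>c\<in>A. fst c) = topspace X \<and>
     (\<forall>c\<in>A. \<forall>c'\<in>A. holomorphically_compatible c c') \<and>
     (\<forall>c. is_chart X c \<and> (\<forall>c'\<in>A. holomorphically_compatible c c') \<longrightarrow> c \<in> A)"

text \<open>Holomorphic maps from an open subset \<open>S\<close> of the manifold to a normed space.\<close>

definition holomorphic_map ::
  "('a, 'm::finite) chart set \<Rightarrow> (complex \<Rightarrow> 'v::real_normed_vector \<Rightarrow> 'v) \<Rightarrow>
   'a set \<Rightarrow> ('a \<Rightarrow> 'v) \<Rightarrow> bool" where
  "holomorphic_map A s S f \<longleftrightarrow>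
     (\<forall>c\<in>A. complex_differentiable_on (*s) s (f \<circ> chart_inv c) (snd c ` (fst c \<inter> S)))"

text \<open>Holomorphic maps from an embedded complex submanifold \<open>S\<close>: around each of its points
  there is a slice chart, in which \<open>S\<close> is a complex linear subspace \<open>E\<close>, and the map is
  holomorphic in the coordinates of the slice. As derivatives are taken within \<open>E\<close>, only the
  restriction of \<open>D\<close> to \<open>E\<close> matters.\<close>

definition slice_chart :: "'a set \<Rightarrow> ('a, 'm::finite) chart \<Rightarrow> (complex ^ 'm) set \<Rightarrow> bool" where
  "slice_chart S c E \<longleftrightarrow> vec.subspace E \<and> snd c ` (fst c \<inter> S) = snd c ` fst c \<inter> E"

definition holomorphic_map_on_submanifold ::
  "('a, 'm::finite) chart set \<Rightarrow> (complex \<Rightarrow> 'v::real_normed_vector \<Rightarrow> 'v) \<Rightarrow>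
   'a set \<Rightarrow> ('a \<Rightarrow> 'v) \<Rightarrow> bool" where
  "holomorphic_map_on_submanifold A s S f \<longleftrightarrow>
     (\<forall>p\<in>S. \<exists>c\<in>A. \<exists>E. p \<in> fst c \<and> slice_chart S c E \<and>
        complex_differentiable_on (*s) s (f \<circ> chart_inv c) (snd c ` fst c \<inter> E))"

section \<open>Complex Lie groups and their Lie algebras\<close>

locale complex_lie_group = group \<G>
  for \<G> :: "('a, 'b) monoid_scheme" (structure)
    and X :: "'a topology" and A :: "('a, 'm::finite) chart set" +
  assumes topspace_eq: "topspace X = carrier \<G>"
    and manifold: "complex_manifold X A"
    and continuous_mult: "continuous_map (prod_topology X X) X (\<lambda>(x, y). x \<otimes> y)"
    and continuous_inv: "continuous_map X X (\<lambda>x. inv x)"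
    and holomorphic_mult: "\<lbrakk>c1 \<in> A; c2 \<in> A; c3 \<in> A\<rbrakk> \<Longrightarrow>
      complex_differentiable_on (\<lambda>a. map_prod ((*s) a) ((*s) a)) (*s)
        (\<lambda>(z, w). snd c3 (chart_inv c1 z \<otimes> chart_inv c2 w))
        {(z, w). z \<in> snd c1 ` fst c1 \<and> w \<in> snd c2 ` fst c2 \<and>
                 chart_inv c1 z \<otimes> chart_inv c2 w \<in> fst c3}"
    and holomorphic_inv: "\<lbrakk>c1 \<in> A; c2 \<in> A\<rbrakk> \<Longrightarrow>
      complex_differentiable_on (*s) (*s) (\<lambda>z. snd c2 (inv (chart_inv c1 z)))
        {z. z \<in> snd c1 ` fst c1 \<and> inv (chart_inv c1 z) \<in> fst c2}"

text \<open>The tangent space at the identity is identified with the model space by means of a fixed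
  chart. The Lie algebra is the model space with the bracket of left-invariant vector fields,
  computed in that chart by \<open>[\<xi>, \<eta>] = D\<eta> \<xi> - D\<xi> \<eta>\<close>.\<close>

definition unit_chart ::
  "('a, 'b) monoid_scheme \<Rightarrow> ('a, 'm::finite) chart set \<Rightarrow> ('a, 'm) chart" where
  "unit_chart \<G> A = (SOME c. c \<in> A \<and> \<one>\<^bsub>\<G>\<^esub> \<in> fst c)"

definition unit_coord ::
  "('a, 'b) monoid_scheme \<Rightarrow> ('a, 'm::finite) chart set \<Rightarrow> complex ^ 'm" where
  "unit_coord \<G> A = snd (unit_chart \<G> A) \<one>\<^bsub>\<G>\<^esub>"

definition left_invariant_field ::
  "('a, 'b) monoid_scheme \<Rightarrow> ('a, 'm::finite) chart set \<Rightarrow>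
   complex ^ 'm \<Rightarrow> complex ^ 'm \<Rightarrow> complex ^ 'm" where
  "left_invariant_field \<G> A \<xi> z =
     (let c = unit_chart \<G> A in
      frechet_derivative (\<lambda>w. snd c (chart_inv c z \<otimes>\<^bsub>\<G>\<^esub> chart_inv c w))
        (at (unit_coord \<G> A)) \<xi>)"

definition lie_bracket ::
  "('a, 'b) monoid_scheme \<Rightarrow> ('a, 'm::finite) chart set \<Rightarrow>
   complex ^ 'm \<Rightarrow> complex ^ 'm \<Rightarrow> complex ^ 'm" where
  "lie_bracket \<G> A \<xi> \<eta> =
     frechet_derivative (left_invariant_field \<G> A \<eta>) (at (unit_coord \<G> A)) \<xi> -
     frechet_derivative (left_invariant_field \<G> A \<xi>) (at (unit_coord \<G> A)) \<eta>"

definition Ad ::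
  "('a, 'b) monoid_scheme \<Rightarrow> ('a, 'm::finite) chart set \<Rightarrow>
   'a \<Rightarrow> complex ^ 'm \<Rightarrow> complex ^ 'm" where
  "Ad \<G> A g =
     (let c = unit_chart \<G> A in
      frechet_derivative (\<lambda>z. snd c (g \<otimes>\<^bsub>\<G>\<^esub> chart_inv c z \<otimes>\<^bsub>\<G>\<^esub> inv\<^bsub>\<G>\<^esub> g))
        (at (unit_coord \<G> A)))"

definition lie_ideal ::
  "('a, 'b) monoid_scheme \<Rightarrow> ('a, 'm::finite) chart set \<Rightarrow> (complex ^ 'm) set \<Rightarrow> bool" where
  "lie_ideal \<G> A I \<longleftrightarrow> vec.subspace I \<and> (\<forall>\<xi>. \<forall>\<eta>\<in>I. lie_bracket \<G> A \<xi> \<eta> \<in> I)"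

definition derived_algebra ::
  "('a, 'b) monoid_scheme \<Rightarrow> ('a, 'm::finite) chart set \<Rightarrow>
   (complex ^ 'm) set \<Rightarrow> (complex ^ 'm) set" where
  "derived_algebra \<G> A I = vec.span {lie_bracket \<G> A \<xi> \<eta> |\<xi> \<eta>. \<xi> \<in> I \<and> \<eta> \<in> I}"

definition lie_solvable ::
  "('a, 'b) monoid_scheme \<Rightarrow> ('a, 'm::finite) chart set \<Rightarrow> (complex ^ 'm) set \<Rightarrow> bool" where
  "lie_solvable \<G> A I \<longleftrightarrow> (\<exists>k. (derived_algebra \<G> A ^^ k) I = {0})"

locale complex_semisimple_lie_group = complex_lie_group +
  assumes semisimple: "\<lbrakk>lie_ideal \<G> A I; lie_solvable \<G> A I\<rbrakk> \<Longrightarrow> I = {0}"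

section \<open>Closed subgroups, real forms and elliptic elements\<close>

text \<open>The Lie algebra of a closed subgroup consists of the initial velocities of the
  one-parameter subgroups it contains, i.e. of the \<open>\<xi>\<close> with \<open>exp (t \<xi>)\<close> in the subgroup
  for all real \<open>t\<close>.\<close>

definition one_parameter_subgroup ::
  "('a, 'b) monoid_scheme \<Rightarrow> 'a topology \<Rightarrow> ('a, 'm::finite) chart set \<Rightarrow>
   complex ^ 'm \<Rightarrow> (real \<Rightarrow> 'a) \<Rightarrow> bool" where
  "one_parameter_subgroup \<G> X A \<xi> \<gamma> \<longleftrightarrow>
     continuous_map euclideanreal X \<gamma> \<and>
     (\<forall>t u. \<gamma> (t + u) = \<gamma> t \<otimes>\<^bsub>\<G>\<^esub> \<gamma> u) \<and>
     ((snd (unit_chart \<G> A) \<circ> \<gamma>) has_vector_derivative \<xi>) (at 0)"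

definition lie_algebra_of ::
  "('a, 'b) monoid_scheme \<Rightarrow> 'a topology \<Rightarrow> ('a, 'm::finite) chart set \<Rightarrow>
   'a set \<Rightarrow> (complex ^ 'm) set" where
  "lie_algebra_of \<G> X A H = {\<xi>. \<exists>\<gamma>. one_parameter_subgroup \<G> X A \<xi> \<gamma> \<and> range \<gamma> \<subseteq> H}"

definition real_form ::
  "('a, 'b) monoid_scheme \<Rightarrow> ('a, 'm::finite) chart set \<Rightarrow> (complex ^ 'm) set \<Rightarrow> bool" where
  "real_form \<G> A \<gg> \<longleftrightarrow>
     subspace \<gg> \<and> (\<forall>\<xi>\<in>\<gg>. \<forall>\<eta>\<in>\<gg>. lie_bracket \<G> A \<xi> \<eta> \<in> \<gg>) \<and>
     \<gg> \<inter> (*s) \<i> ` \<gg> = {0} \<and> {\<xi> + \<i> *s \<eta> |\<xi> \<eta>. \<xi> \<in> \<gg> \<and> \<eta> \<in> \<gg>} = UNIV"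

definition semisimple_endomorphism_on ::
  "'u::real_vector set \<Rightarrow> ('u \<Rightarrow> 'u) \<Rightarrow> bool" where
  "semisimple_endomorphism_on V f \<longleftrightarrow>
     (\<forall>W. subspace W \<and> W \<subseteq> V \<and> f ` W \<subseteq> W \<longrightarrow>
        (\<exists>W'. subspace W' \<and> W' \<subseteq> V \<and> f ` W' \<subseteq> W' \<and>
              W \<inter> W' = {0} \<and> {w + w' |w w'. w \<in> W \<and> w' \<in> W'} = V))"

text \<open>For a real form \<open>\<gg>\<close> the complexification of \<open>\<gg>\<close> is the whole model space, so the
  complex eigenvalues of \<open>ad T\<close> are those of the bracket with \<open>T\<close> on the model space.\<close>

definition elliptic ::
  "('a, 'b) monoid_scheme \<Rightarrow> ('a, 'm::finite) chart set \<Rightarrow>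
   (complex ^ 'm) set \<Rightarrow> complex ^ 'm \<Rightarrow> bool" where
  "elliptic \<G> A \<gg> T \<longleftrightarrow> T \<in> \<gg> \<and>
     semisimple_endomorphism_on \<gg> (lie_bracket \<G> A T) \<and>
     (\<forall>\<mu> \<xi>. \<xi> \<noteq> 0 \<and> lie_bracket \<G> A T \<xi> = \<mu> *s \<xi> \<longrightarrow> Re \<mu> = 0)"

definition centralizer_of ::
  "('a, 'b) monoid_scheme \<Rightarrow> ('a, 'm::finite) chart set \<Rightarrow> 'a set \<Rightarrow> complex ^ 'm \<Rightarrow> 'a set" where
  "centralizer_of \<G> A G T = {g \<in> G. Ad \<G> A g T = T}"

definition eigenspace ::
  "('a, 'b) monoid_scheme \<Rightarrow> ('a, 'm::finite) chart set \<Rightarrow>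
   complex ^ 'm \<Rightarrow> real \<Rightarrow> (complex ^ 'm) set" where
  "eigenspace \<G> A T l = {\<xi>. lie_bracket \<G> A T \<xi> = (\<i> * of_real l) *s \<xi>}"

definition Q_minus ::
  "('a, 'b) monoid_scheme \<Rightarrow> ('a, 'm::finite) chart set \<Rightarrow> complex ^ 'm \<Rightarrow> 'a set" where
  "Q_minus \<G> A T =
     (let \<uu> = vec.span (\<Union>\<nu>\<in>{0..}. eigenspace \<G> A T (- \<nu>))
      in {q \<in> carrier \<G>. Ad \<G> A q ` \<uu> \<subseteq> \<uu>})"

section \<open>Continuous representations\<close>

definition linear_on :: "(complex \<Rightarrow> 'w::plus \<Rightarrow> 'w) \<Rightarrow> 'w set \<Rightarrow> ('w \<Rightarrow> 'w) \<Rightarrow> bool" where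
  "linear_on s W f \<longleftrightarrow> (\<forall>v\<in>W. \<forall>w\<in>W. f (v + w) = f v + f w) \<and> (\<forall>c. \<forall>v\<in>W. f (s c v) = s c (f v))"

definition GL :: "(complex \<Rightarrow> 'w::plus \<Rightarrow> 'w) \<Rightarrow> 'w set \<Rightarrow> ('w \<Rightarrow> 'w) monoid" where
  "GL s W = BijGroup W \<lparr>carrier := {f \<in> Bij W. linear_on s W f}\<rparr>"

definition continuous_representation ::
  "('a, 'b) monoid_scheme \<Rightarrow> 'a topology \<Rightarrow> (complex \<Rightarrow> 'w::ab_group_add \<Rightarrow> 'w) \<Rightarrow> 'w set \<Rightarrow>
   ('w \<Rightarrow> 'w \<Rightarrow> real) \<Rightarrow> ('a \<Rightarrow> 'w \<Rightarrow> 'w) \<Rightarrow> bool" where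
  "continuous_representation H Y s W d r \<longleftrightarrow>
     module.subspace s W \<and> Metric_space W d \<and> r \<in> hom H (GL s W) \<and>
     continuous_map (prod_topology Y (Metric_space.mtopology W d)) (Metric_space.mtopology W d)
       (\<lambda>(g, w). r g w)"

text \<open>A holomorphic homomorphism from \<open>Q\<close> to the general linear group of the finite-dimensional
  space with scalar multiplication \<open>s\<close>; holomorphy is that of a map to the normed space of
  linear operators, with scalar multiplication \<open>(c T) v = c (T v)\<close>.\<close>

definition holomorphic_GL_hom ::
  "('a, 'b) monoid_scheme \<Rightarrow> ('a, 'm::finite) chart set \<Rightarrow>
   (complex \<Rightarrow> 'v::real_normed_vector \<Rightarrow> 'v) \<Rightarrow> 'a set \<Rightarrow> ('a \<Rightarrow> 'v \<Rightarrow> 'v) \<Rightarrow> bool" where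
  "holomorphic_GL_hom \<G> A s Q \<rho> \<longleftrightarrow>
     \<rho> \<in> hom (\<G>\<lparr>carrier := Q\<rparr>) (GL s UNIV) \<and>
     holomorphic_map_on_submanifold A (\<lambda>c T. Blinfun (\<lambda>v. s c (blinfun_apply T v)))
       Q (\<lambda>q. Blinfun (\<rho> q))"

section \<open>The representation space\<close>

definition fun_scale :: "(complex \<Rightarrow> 'v \<Rightarrow> 'v) \<Rightarrow> complex \<Rightarrow> ('a \<Rightarrow> 'v) \<Rightarrow> 'a \<Rightarrow> 'v" where
  "fun_scale s c \<psi> = (\<lambda>x. s c (\<psi> x))"

text \<open>Maps defined on \<open>\<Omega>\<close> are represented by functions that vanish outside \<open>\<Omega>\<close>, so that the
  vector space operations are pointwise and equality is equality on \<open>\<Omega>\<close>.\<close>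

definition equivariant_holomorphic_maps ::
  "('a, 'b) monoid_scheme \<Rightarrow> ('a, 'm::finite) chart set \<Rightarrow>
   (complex \<Rightarrow> 'v::real_normed_vector \<Rightarrow> 'v) \<Rightarrow> 'a set \<Rightarrow> 'a set \<Rightarrow> ('a \<Rightarrow> 'v \<Rightarrow> 'v) \<Rightarrow>
   ('a \<Rightarrow> 'v) set" where
  "equivariant_holomorphic_maps \<G> A s \<Omega> Q \<rho> =
     {\<psi>. (\<forall>x. x \<notin> \<Omega> \<longrightarrow> \<psi> x = 0) \<and> holomorphic_map A s \<Omega> \<psi> \<and>
          (\<forall>x\<in>\<Omega>. \<forall>q\<in>Q. \<psi> (x \<otimes>\<^bsub>\<G>\<^esub> q) = inv_into UNIV (\<rho> q) (\<psi> x))}"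

definition translation_rep ::
  "('a, 'b) monoid_scheme \<Rightarrow> 'a set \<Rightarrow> ('a \<Rightarrow> 'v::zero) set \<Rightarrow> 'a \<Rightarrow> ('a \<Rightarrow> 'v) \<Rightarrow> 'a \<Rightarrow> 'v" where
  "translation_rep \<G> \<Omega> \<V> g =
     (\<lambda>\<psi>\<in>\<V>. \<lambda>x. if x \<in> \<Omega> then \<psi> (inv\<^bsub>\<G>\<^esub> g \<otimes>\<^bsub>\<G>\<^esub> x) else 0)"

definition sup_dist :: "'a set \<Rightarrow> ('a \<Rightarrow> 'v::real_normed_vector) \<Rightarrow> ('a \<Rightarrow> 'v) \<Rightarrow> real" where
  "sup_dist E \<psi>1 \<psi>2 = (SUP y\<in>E. norm (\<psi>1 y - \<psi>2 y))"

text \<open>The sequence of compact sets is indexed from 0, hence the weights \<open>1/2^(n+1)\<close>. The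
  library's \<open>Metric_space\<close> asks for nonnegativity and symmetry on the whole type, whereas the
  suprema are only meaningful for functions bounded on the sets \<open>E n\<close>; the distance is therefore
  set to 0 outside the carrier \<open>\<V>\<close>, which does not affect the metric space.\<close>

definition frechet_metric ::
  "('a \<Rightarrow> 'v::real_normed_vector) set \<Rightarrow> (nat \<Rightarrow> 'a set) \<Rightarrow> ('a \<Rightarrow> 'v) \<Rightarrow> ('a \<Rightarrow> 'v) \<Rightarrow> real" where
  "frechet_metric \<V> E \<psi>1 \<psi>2 =
     (if \<psi>1 \<in> \<V> \<and> \<psi>2 \<in> \<V>
      then \<Sum>n. (1 / 2 ^ Suc n) * (sup_dist (E n) \<psi>1 \<psi>2 / (1 + sup_dist (E n) \<psi>1 \<psi>2))
      else 0)"

end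

theory Submission
  imports Defs
begin

text \<open>Translation by \<open>G\<close> on the left commutes with the action of \<open>Q\<close> on the right, so it preserves
  equivariance, and it preserves holomorphy because left translations of a complex Lie group are
  holomorphic (\<open>holomorphic_map_left_translate\<close>). Hence \<open>G\<close> acts on the space of equivariant
  holomorphic maps by invertible linear maps (\<open>translation_hom\<close>).

  Continuity of the action is a fact of general topology. The metric describes uniform convergence on compact sets, and any continuous action of a topological space
  of parameters on the domain induces a jointly continuous action on continuous functions with this
  topology (\<open>continuous_map_translation\<close>): for a compact set \<open>K\<close> the map \<open>(g, y) \<mapsto> g\<inverse> y\<close> sends a
  neighbourhood of \<open>{g0} \<times> K\<close> into a finite union \<open>W\<close> of the sets \<open>O' n\<close>, and the tube lemma makes
  this neighbourhood a product. Thus \<open>f\<close> and \<open>f0\<close> need only be close on \<open>W\<close>, on which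
  the metric controls them, and the translates of \<open>f0\<close> are close on \<open>K\<close> by continuity of \<open>f0\<close>.

  All derivatives are taken within the image of \<open>G Q\<close> in a chart, and the chain rule is applied
  in this relative form.\<close>

section \<open>The metric of uniform convergence on compact sets\<close>

text \<open>The Frechet metric makes sense for any vector-valued continuous functions on a space that is
  covered by countably many non-empty open sets \<open>U n\<close>, each contained in a compact set \<open>E n\<close>. The
  functions vanish outside the space, so that they are determined by their values on it, and the
  sets are non-empty because the supremum of the empty set of reals is an arbitrary number.\<close>

locale functions_on_compact_cover =
  fixes Y :: "'a topology" and U E :: "nat \<Rightarrow> 'a set"
    and V :: "('a \<Rightarrow> 'v::real_normed_vector) set"
  assumes openin_cover: "openin Y (U n)"
    and cover_nonempty: "U n \<noteq> {}"
    and cover_subset: "U n \<subseteq> E n"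
    and compactin_cover: "compactin Y (E n)"
    and covers: "(\<Union>n. U n) = topspace Y"
    and continuous: "f \<in> V \<Longrightarrow> continuous_map Y euclidean f"
    and vanishes_outside: "\<lbrakk>f \<in> V; x \<notin> topspace Y\<rbrakk> \<Longrightarrow> f x = 0"
begin

lemma bounded_diff:
  assumes "f \<in> V" "g \<in> V"
  shows "bdd_above ((\<lambda>y. norm (f y - g y)) ` E n)"
proof -
  have *: "bounded (h ` E n)" if "h \<in> V" for h
    using image_compactin[OF compactin_cover continuous[OF that]]
    by (simp add: compact_imp_bounded)
  obtain a b where ab: "\<forall>y\<in>E n. norm (f y) \<le> a" "\<forall>y\<in>E n. norm (g y) \<le> b"
    using *[OF assms(1)] *[OF assms(2)] unfolding bounded_iff by auto
  have "norm (f y - g y) \<le> a + b" if "y \<in> E n" for y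
    using norm_triangle_ineq4[of "f y" "g y"] ab that by fastforce
  then show ?thesis by (rule bdd_aboveI2)
qed

lemma E_nonempty: "E n \<noteq> {}"
  using cover_nonempty cover_subset by blast

lemma norm_diff_le_sup_dist:
  assumes "f \<in> V" "g \<in> V" "y \<in> E n"
  shows "norm (f y - g y) \<le> sup_dist (E n) f g"
  unfolding sup_dist_def using cSUP_upper[OF assms(3) bounded_diff[OF assms(1,2)]] .

lemma sup_dist_le:
  assumes "\<And>y. y \<in> E n \<Longrightarrow> norm (f y - g y) \<le> c"
  shows "sup_dist (E n) f g \<le> c"
  unfolding sup_dist_def using assms by (intro cSUP_least E_nonempty)

lemma sup_dist_nonneg:
  assumes "f \<in> V" "g \<in> V"
  shows "0 \<le> sup_dist (E n) f g"
  using norm_diff_le_sup_dist[OF assms] E_nonempty norm_ge_zero order_trans by blast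

lemma sup_dist_commute: "sup_dist D f g = sup_dist D g f"
  unfolding sup_dist_def by (simp add: norm_minus_commute)

lemma sup_dist_triangle:
  assumes "f \<in> V" "g \<in> V" "h \<in> V"
  shows "sup_dist (E n) f h \<le> sup_dist (E n) f g + sup_dist (E n) g h"
proof (rule sup_dist_le)
  fix y assume y: "y \<in> E n"
  have "norm (f y - h y) \<le> norm (f y - g y) + norm (g y - h y)"
    using norm_triangle_ineq[of "f y - g y" "g y - h y"] by simp
  also have "\<dots> \<le> sup_dist (E n) f g + sup_dist (E n) g h"
    using assms y by (intro add_mono norm_diff_le_sup_dist)
  finally show "norm (f y - h y) \<le> \<dots>" .
qed

text \<open>The function \<open>t / (1 + t)\<close> turns the suprema, which may tend to infinity with \<open>n\<close>, into numbers
  bounded by 1, so that the weighted series converges; as the function is increasing and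
  subadditive, smallness and the triangle inequality survive.\<close>

definition summand :: "('a \<Rightarrow> 'v) \<Rightarrow> ('a \<Rightarrow> 'v) \<Rightarrow> nat \<Rightarrow> real" where
  "summand f g n = (1/2) ^ Suc n * (sup_dist (E n) f g / (1 + sup_dist (E n) f g))"

abbreviation d where "d \<equiv> frechet_metric V E"

lemma metric_eq: "\<lbrakk>f \<in> V; g \<in> V\<rbrakk> \<Longrightarrow> d f g = (\<Sum>n. summand f g n)"
  by (simp add: frechet_metric_def summand_def power_one_over)

lemma frac_mono: "\<lbrakk>0 \<le> t; t \<le> u\<rbrakk> \<Longrightarrow> t / (1 + t) \<le> u / (1 + (u::real))"
  by (simp add: field_simps)

lemma summand_nonneg: "\<lbrakk>f \<in> V; g \<in> V\<rbrakk> \<Longrightarrow> 0 \<le> summand f g n"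
  by (simp add: summand_def sup_dist_nonneg)

lemma summand_le:
  assumes "f \<in> V" "g \<in> V"
  shows "summand f g n \<le> (1/2) ^ Suc n"
proof -
  have "sup_dist (E n) f g / (1 + sup_dist (E n) f g) \<le> 1"
    using sup_dist_nonneg[OF assms, of n] by simp
  then show ?thesis
    unfolding summand_def by (intro mult_left_le) auto
qed

lemma summable_weights: "summable (\<lambda>n. (1/2::real) ^ Suc n)"
  by (subst summable_Suc_iff) (simp add: summable_geometric)

lemma summable_summand: "\<lbrakk>f \<in> V; g \<in> V\<rbrakk> \<Longrightarrow> summable (summand f g)"
  by (rule summable_comparison_test'[OF summable_weights, of 0])
    (use summand_nonneg summand_le in auto)

lemma summand_le_metric: "\<lbrakk>f \<in> V; g \<in> V\<rbrakk> \<Longrightarrow> summand f g n \<le> d f g"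
  using sum_le_suminf[of "summand f g" "{n}"]
  by (simp add: metric_eq summable_summand summand_nonneg)

lemma summand_triangle:
  assumes "f \<in> V" "g \<in> V" "h \<in> V"
  shows "summand f h n \<le> summand f g n + summand g h n"
proof -
  define a b c where "a = sup_dist (E n) f g" and "b = sup_dist (E n) g h"
    and "c = sup_dist (E n) f h"
  have "0 \<le> a" "0 \<le> b" "0 \<le> c" "c \<le> a + b"
    using assms sup_dist_nonneg sup_dist_triangle by (auto simp: a_def b_def c_def)
  then have "c / (1 + c) \<le> (a + b) / (1 + (a + b))"
    by (intro frac_mono) auto
  also have "\<dots> = a / (1 + (a + b)) + b / (1 + (a + b))"
    by (simp add: add_divide_distrib)
  also have "\<dots> \<le> a / (1 + a) + b / (1 + b)"
    using \<open>0 \<le> a\<close> \<open>0 \<le> b\<close> by (intro add_mono divide_left_mono) auto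
  finally have "(1/2) ^ Suc n * (c / (1 + c)) \<le> (1/2) ^ Suc n * (a / (1 + a) + b / (1 + b))"
    by (intro mult_left_mono) auto
  then show ?thesis
    by (simp add: summand_def a_def b_def c_def distrib_left)
qed

text \<open>The metric dominates each single summand, and the \<open>n\<close>-th summand is below
  \<open>(1/2) ^ Suc n * (e / (1 + e))\<close> exactly if the supremum over \<open>E n\<close> is below \<open>e\<close>. The smallest of
  these thresholds for \<open>n \<le> N\<close> is the one for \<open>N\<close>.\<close>

lemma metric_small_imp_uniformly_small:
  assumes "0 < e"
  shows "\<exists>\<delta>>0. \<forall>f\<in>V. \<forall>g\<in>V. d f g < \<delta> \<longrightarrow> (\<forall>n\<le>N. \<forall>y\<in>E n. norm (f y - g y) < e)"
proof (intro exI[of _ "(1/2) ^ Suc N * (e / (1 + e))"] conjI ballI impI allI)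
  fix f g n y
  assume fg: "f \<in> V" "g \<in> V" and "d f g < (1/2) ^ Suc N * (e / (1 + e))"
    and "n \<le> N" and y: "y \<in> E n"
  have "summand f g n < (1/2) ^ Suc N * (e / (1 + e))"
    using summand_le_metric[OF fg] \<open>d f g < _\<close> by (rule le_less_trans)
  also have "\<dots> \<le> (1/2) ^ Suc n * (e / (1 + e))"
    using \<open>n \<le> N\<close> assms by (intro mult_right_mono power_decreasing) auto
  finally have "sup_dist (E n) f g / (1 + sup_dist (E n) f g) < e / (1 + e)"
    unfolding summand_def by (subst (asm) mult_less_cancel_left_pos) auto
  then have "sup_dist (E n) f g < e"
    using frac_mono[of e "sup_dist (E n) f g"] assms by fastforce
  then show "norm (f y - g y) < e"
    using norm_diff_le_sup_dist[OF fg y] by linarith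
qed (use assms in auto)

text \<open>The tail of the series is at most \<open>(1/2) ^ N\<close> whatever the functions are, so only the first
  \<open>N\<close> compact sets matter.\<close>

lemma uniformly_small_imp_metric_small:
  assumes "0 < e"
  shows "\<exists>N. \<exists>\<delta>>0. \<forall>f\<in>V. \<forall>g\<in>V.
    (\<forall>n<N. \<forall>y\<in>E n. norm (f y - g y) \<le> \<delta>) \<longrightarrow> d f g < e"
proof -
  obtain N where N: "(1/2::real) ^ N < e / 2"
    using real_arch_pow_inv[of "e/2" "1/2"] assms by auto
  show ?thesis
  proof (intro exI[of _ N] exI[of _ "e/2"] conjI ballI impI)
    fix f g
    assume fg: "f \<in> V" "g \<in> V" and small: "\<forall>n<N. \<forall>y\<in>E n. norm (f y - g y) \<le> e / 2"
    have head: "summand f g n \<le> (1/2) ^ Suc n * (e/2)" if "n < N" for n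
    proof -
      have "sup_dist (E n) f g \<le> e / 2"
        using small that by (intro sup_dist_le) auto
      moreover have "sup_dist (E n) f g / (1 + sup_dist (E n) f g) \<le> sup_dist (E n) f g"
        using sup_dist_nonneg[OF fg, of n] by (simp add: field_simps)
      ultimately have "sup_dist (E n) f g / (1 + sup_dist (E n) f g) \<le> e / 2"
        by (rule order_trans[rotated])
      then show ?thesis
        unfolding summand_def by (intro mult_left_mono) auto
    qed
    have weights: "(\<Sum>n. (1/2::real) ^ Suc (n + k)) = (1/2) ^ k" for k
    proof -
      have "(\<Sum>n. (1/2::real) ^ Suc (n + k)) = (\<Sum>n. (1/2) ^ k * (1/2) ^ Suc n)"
        by (simp add: power_add mult.commute)
      also have "\<dots> = (1/2) ^ k * (\<Sum>n. (1/2) ^ Suc n)"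
        by (rule suminf_mult[OF summable_weights])
      also have "(\<Sum>n. (1/2::real) ^ Suc n) = 1"
        using power_half_series by (rule sums_unique[symmetric])
      finally show ?thesis by simp
    qed
    have "d f g = (\<Sum>n. summand f g (n + N)) + (\<Sum>n<N. summand f g n)"
      using suminf_split_initial_segment[OF summable_summand[OF fg], of N]
      by (simp add: metric_eq fg)
    also have "(\<Sum>n. summand f g (n + N)) \<le> (\<Sum>n. (1/2) ^ Suc (n + N))"
      using summand_le[OF fg] summable_summand[OF fg] summable_weights
      by (intro suminf_le) (auto intro: summable_ignore_initial_segment
          simp del: power_Suc)
    also have "\<dots> = (1/2) ^ N"
      by (rule weights)
    also have "(\<Sum>n<N. summand f g n) \<le> (\<Sum>n<N. (1/2) ^ Suc n * (e/2))"
      using head by (intro sum_mono) auto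
    also have "\<dots> \<le> e / 2"
    proof -
      have "(\<Sum>n<N. (1/2::real) ^ Suc n) \<le> (\<Sum>n. (1/2) ^ Suc n)"
        by (intro sum_le_suminf summable_weights) auto
      then have "(\<Sum>n<N. (1/2::real) ^ Suc n) \<le> 1"
        using weights[of 0] by simp
      then have "(\<Sum>n<N. (1/2::real) ^ Suc n) * (e/2) \<le> 1 * (e/2)"
        using assms by (intro mult_right_mono) auto
      then show ?thesis
        by (simp only: sum_distrib_right mult_1)
    qed
    finally show "d f g < e"
      using N by simp
  qed (use assms in simp)
qed

sublocale Metric_space V d
proof
  fix f g
  show "0 \<le> d f g"
  proof (cases "f \<in> V \<and> g \<in> V")
    case True
    then show ?thesis
      using metric_eq summable_summand summand_nonneg suminf_nonneg by metis
  next
    case False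
    then show ?thesis
      unfolding frechet_metric_def by (simp only: if_False order_refl)
  qed
  show "d f g = d g f"
    by (auto simp: frechet_metric_def sup_dist_commute)
next
  fix f g assume fg: "f \<in> V" "g \<in> V"
  show "d f g = 0 \<longleftrightarrow> f = g"
  proof
    assume 0: "d f g = 0"
    show "f = g"
    proof
      fix x
      show "f x = g x"
      proof (cases "x \<in> topspace Y")
        case True
        then obtain n where x: "x \<in> E n"
          using covers cover_subset by blast
        have "norm (f x - g x) < e" if "0 < e" for e
          using metric_small_imp_uniformly_small[OF that, of n] 0 fg x by fastforce
        then have "norm (f x - g x) \<le> 0"
          using field_le_epsilon[of "norm (f x - g x)" 0] by (simp add: less_imp_le)
        then show ?thesis by simp
      qed (simp add: vanishes_outside[OF fg(1)] vanishes_outside[OF fg(2)])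
    qed
  next
    assume "f = g"
    then show "d f g = 0"
      using fg E_nonempty by (simp add: frechet_metric_def sup_dist_def)
  qed
next
  fix f g h assume fgh: "f \<in> V" "g \<in> V" "h \<in> V"
  have "d f h \<le> (\<Sum>n. summand f g n + summand g h n)"
    unfolding metric_eq[OF fgh(1,3)]
    using fgh summand_triangle by (intro suminf_le summable_add summable_summand) auto
  also have "\<dots> = d f g + d g h"
    using fgh by (simp add: metric_eq suminf_add summable_summand)
  finally show "d f h \<le> d f g + d g h" .
qed

text \<open>With the two preceding estimates this says that the metric induces uniform convergence on
  compact sets. The cover by the open sets \<open>U n\<close> is essential here: a cover by compact sets alone
  need not have finite subcovers of compact sets.\<close>

lemma compactin_imp_subset_finite_union:
  assumes "compactin Y K"
  shows "\<exists>N. K \<subseteq> (\<Union>n\<le>N. U n)"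
proof -
  have "K \<subseteq> \<Union> (range U)"
    using compactin_subset_topspace[OF assms] covers by simp
  then obtain F where "finite F" "F \<subseteq> range U" "K \<subseteq> \<Union> F"
    using assms openin_cover unfolding compactin_def by (metis rangeE)
  then obtain I where "finite I" "F = U ` I"
    by (meson finite_subset_image)
  then have "K \<subseteq> (\<Union>n\<le>Max I. U n)"
    using \<open>K \<subseteq> \<Union> F\<close> by fastforce
  then show ?thesis ..
qed

text \<open>For functions \<open>f0\<close>, \<open>f\<close> and group elements \<open>g0\<close>, \<open>g\<close> the difference of the translates at
  \<open>y\<close> splits as
  \<open>(f0 (a (g0, y)) - f0 (a (g, y))) + (f0 (a (g, y)) - f (a (g, y)))\<close>.
  It has to be small for all \<open>y\<close> in a compact set \<open>K\<close>. The tube lemma makes the first term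
  small on \<open>K\<close> for all \<open>g\<close> near \<open>g0\<close>. The translate of \<open>K\<close> by \<open>g0\<close> lies in a finite
  union of the open sets \<open>U n\<close>; again by the tube lemma this union contains the translates of
  \<open>K\<close> by all \<open>g\<close> near \<open>g0\<close>, and so a single bound on \<open>f0 - f\<close>, uniform on that union, controls
  the second term. The finite union serves here as a neighbourhood of the translate of \<open>K\<close> that is
  contained in a compact set.\<close>

theorem continuous_map_translation:
  assumes action: "continuous_map (prod_topology H Y) Y a"
    and preserves: "\<And>g f. \<lbrakk>g \<in> topspace H; f \<in> V\<rbrakk> \<Longrightarrow> r g f \<in> V"
    and translate: "\<And>g f y. \<lbrakk>g \<in> topspace H; f \<in> V; y \<in> topspace Y\<rbrakk> \<Longrightarrow> r g f y = f (a (g, y))"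
  shows "continuous_map (prod_topology H mtopology) mtopology (\<lambda>(g, f). r g f)"
  unfolding continuous_map_to_metric
proof (intro ballI allI impI)
  fix p \<epsilon> assume "p \<in> topspace (prod_topology H mtopology)" and \<epsilon>: "0 < (\<epsilon>::real)"
  then obtain g0 f0 where p: "p = (g0, f0)" and g0: "g0 \<in> topspace H" and f0: "f0 \<in> V"
    by auto
  obtain N \<delta> where \<delta>: "0 < \<delta>" and near:
    "\<And>f g. \<lbrakk>f \<in> V; g \<in> V; \<forall>n<N. \<forall>y\<in>E n. norm (f y - g y) \<le> \<delta>\<rbrakk> \<Longrightarrow> d f g < \<epsilon>"
    using uniformly_small_imp_metric_small[OF \<epsilon>] by blast
  define K where "K = (\<Union>n<N. E n)"
  have K: "compactin Y K"
    unfolding K_def using compactin_cover by (intro compactin_Union) auto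
  have slice: "continuous_map Y Y (\<lambda>y. a (g0, y))"
    using g0 by (intro continuous_map_compose[OF _ action, unfolded o_def])
      (simp add: continuous_map_pairwise o_def)
  obtain M where M: "(\<lambda>y. a (g0, y)) ` K \<subseteq> (\<Union>n\<le>M. U n)"
    using compactin_imp_subset_finite_union[OF image_compactin[OF K slice]] by blast
  \<comment> \<open>\<open>W1\<close> keeps the translated point in the region where \<open>f0\<close> and \<open>f\<close> are close.\<close>
  define W1 where "W1 = {p \<in> topspace (prod_topology H Y). a p \<in> (\<Union>n\<le>M. U n)}"
  have W1: "openin (prod_topology H Y) W1"
    unfolding W1_def using openin_cover
    by (intro openin_continuous_map_preimage[OF action] openin_Union) auto
  \<comment> \<open>\<open>W2\<close> makes the translates of \<open>f0\<close> itself close.\<close>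
  define W2 where "W2 = {p \<in> topspace (prod_topology H Y).
    f0 (a p) - f0 (a (g0, snd p)) \<in> ball 0 (\<delta>/2)}"
  have W2: "openin (prod_topology H Y) W2"
    unfolding W2_def
  proof (rule openin_continuous_map_preimage)
    have "continuous_map (prod_topology H Y) euclidean (\<lambda>p. f0 (a p))"
      using continuous_map_compose[OF action continuous[OF f0]] by (simp add: o_def)
    moreover have "continuous_map (prod_topology H Y) euclidean (\<lambda>p. f0 (a (g0, snd p)))"
      using continuous_map_compose[OF continuous_map_compose[OF continuous_map_snd slice]
          continuous[OF f0]] by (simp add: o_def)
    ultimately show "continuous_map (prod_topology H Y) euclidean
        (\<lambda>p. f0 (a p) - f0 (a (g0, snd p)))"
      by (rule continuous_map_diff)
  qed simp
  have "{g0} \<times> K \<subseteq> W1 \<inter> W2"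
    using M g0 compactin_subset_topspace[OF K] \<delta> by (auto simp: W1_def W2_def)
  then obtain S where S: "openin H S" "g0 \<in> S" "S \<times> K \<subseteq> W1 \<inter> W2"
    using tube_lemma_right[OF openin_Int[OF W1 W2] K g0] by blast
  obtain \<eta> where \<eta>: "0 < \<eta>" and close:
    "\<And>f g n y. \<lbrakk>f \<in> V; g \<in> V; d f g < \<eta>; n \<le> M; y \<in> E n\<rbrakk> \<Longrightarrow> norm (f y - g y) < \<delta>/2"
    using metric_small_imp_uniformly_small[of "\<delta>/2" M] \<delta> by auto
  show "\<exists>W. openin (prod_topology H mtopology) W \<and> p \<in> W \<and>
      (\<forall>q\<in>W. (\<lambda>(g, f). r g f) q \<in> mball ((\<lambda>(g, f). r g f) p) \<epsilon>)"
  proof (intro exI conjI ballI)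
    show "openin (prod_topology H mtopology) (S \<times> mball f0 \<eta>)"
      using S by (simp add: openin_prod_Times_iff)
    show "p \<in> S \<times> mball f0 \<eta>"
      using S f0 \<eta> p by simp
  next
    fix q assume "q \<in> S \<times> mball f0 \<eta>"
    then obtain g f where q: "q = (g, f)" and g: "g \<in> S" and f: "f \<in> V" "d f0 f < \<eta>"
      by auto
    have gH: "g \<in> topspace H"
      using S g openin_subset by blast
    have "d (r g0 f0) (r g f) < \<epsilon>"
    proof (intro near preserves g0 f0 gH f allI impI ballI)
      fix n y assume "n < N" "y \<in> E n"
      then have yK: "y \<in> K" and yY: "y \<in> topspace Y"
        using compactin_subset_topspace[OF compactin_cover] by (auto simp: K_def)
      have W: "(g, y) \<in> W1" "(g, y) \<in> W2"
        using S g yK by auto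
      from W(1) obtain m where "m \<le> M" "a (g, y) \<in> E m"
        using cover_subset by (auto simp: W1_def)
      then have "norm (f0 (a (g, y)) - f (a (g, y))) < \<delta>/2"
        using close f0 f by blast
      moreover have "norm (f0 (a (g0, y)) - f0 (a (g, y))) < \<delta>/2"
        using W(2) by (simp add: W2_def norm_minus_commute)
      ultimately have "norm (f0 (a (g0, y)) - f (a (g, y))) < \<delta>"
        using norm_diff_triangle_less[of "f0 (a (g0, y))" "f0 (a (g, y))" "\<delta>/2" "f (a (g, y))" "\<delta>/2"]
        by simp
      then show "norm (r g0 f0 y - r g f y) \<le> \<delta>"
        using translate g0 f0 gH f yY by simp
    qed
    then show "(\<lambda>(g, f). r g f) q \<in> mball ((\<lambda>(g, f). r g f) p) \<epsilon>"
      using preserves g0 f0 gH f by (simp add: p q)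
  qed
qed

end

section \<open>Complex differentiability within arbitrary sets\<close>

lemma complex_differentiable_on_subset:
  "\<lbrakk>complex_differentiable_on s s' f S; S' \<subseteq> S\<rbrakk> \<Longrightarrow> complex_differentiable_on s s' f S'"
  unfolding complex_differentiable_on_def by (meson has_derivative_subset subsetD)

lemma complex_differentiable_on_cong:
  assumes "complex_differentiable_on s s' f S" and eq: "\<And>z. z \<in> S \<Longrightarrow> f z = g z"
  shows "complex_differentiable_on s s' g S"
  unfolding complex_differentiable_on_def
proof
  fix z assume z: "z \<in> S"
  then obtain D where "(f has_derivative D) (at z within S)" "\<forall>c v. D (s c v) = s' c (D v)"
    using assms(1) unfolding complex_differentiable_on_def by blast
  then show "\<exists>D. (g has_derivative D) (at z within S) \<and> (\<forall>c v. D (s c v) = s' c (D v))"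
    using has_derivative_transform[OF z, of g f D] eq by auto
qed

text \<open>The inner map has to carry \<open>S\<close> into \<open>S'\<close> because both derivatives are taken within sets that
  may fail to be open; the derivative of \<open>g\<close> says nothing about directions that leave \<open>S'\<close>.\<close>

lemma complex_differentiable_on_compose:
  assumes f: "complex_differentiable_on s1 s2 f S"
    and g: "complex_differentiable_on s2 s3 g S'"
    and sub: "f ` S \<subseteq> S'"
  shows "complex_differentiable_on s1 s3 (\<lambda>z. g (f z)) S"
  unfolding complex_differentiable_on_def
proof
  fix z assume z: "z \<in> S"
  obtain D where D: "(f has_derivative D) (at z within S)" "\<forall>c v. D (s1 c v) = s2 c (D v)"
    using f z unfolding complex_differentiable_on_def by blast
  obtain D' where D': "(g has_derivative D') (at (f z) within S')"
    "\<forall>c v. D' (s2 c v) = s3 c (D' v)"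
    using g z sub unfolding complex_differentiable_on_def by blast
  have "((\<lambda>z. g (f z)) has_derivative (\<lambda>v. D' (D v))) (at z within S)"
    using has_derivative_in_compose[OF D(1)] has_derivative_subset[OF D'(1) sub] by blast
  then show "\<exists>D. ((\<lambda>z. g (f z)) has_derivative D) (at z within S) \<and>
      (\<forall>c v. D (s1 c v) = s3 c (D v))"
    using D(2) D'(2) by auto
qed

text \<open>An open neighbourhood of a point does not change the filter of its neighbourhoods within \<open>S\<close>.\<close>

lemma complex_differentiable_on_local:
  assumes "\<And>z. z \<in> S \<Longrightarrow> \<exists>N. open N \<and> z \<in> N \<and> complex_differentiable_on s s' f (S \<inter> N)"
  shows "complex_differentiable_on s s' f S"
  unfolding complex_differentiable_on_def
proof
  fix z assume z: "z \<in> S"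
  then obtain N where N: "open N" "z \<in> N" "complex_differentiable_on s s' f (S \<inter> N)"
    using assms by blast
  then have "at z within (S \<inter> N) = at z within S"
    by (intro at_within_nhd[of z N]) auto
  then show "\<exists>D. (f has_derivative D) (at z within S) \<and> (\<forall>c v. D (s c v) = s' c (D v))"
    using N z unfolding complex_differentiable_on_def by (metis IntI)
qed

lemma complex_differentiable_on_imp_continuous_on:
  "complex_differentiable_on s s' f S \<Longrightarrow> continuous_on S f"
  unfolding complex_differentiable_on_def continuous_on_eq_continuous_within
  using has_derivative_continuous by blast

section \<open>Holomorphic maps to a complex normed space\<close>

context fin_dim_complex_normed_space
begin

lemma complex_differentiable_on_zero: "complex_differentiable_on s' s (\<lambda>z. 0) S"
  unfolding complex_differentiable_on_def by (auto intro: has_derivative_const)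

lemma complex_differentiable_on_add:
  assumes "complex_differentiable_on s' s f S" "complex_differentiable_on s' s g S"
  shows "complex_differentiable_on s' s (\<lambda>z. f z + g z) S"
  unfolding complex_differentiable_on_def
proof
  fix z assume z: "z \<in> S"
  obtain D where D: "(f has_derivative D) (at z within S)" "\<forall>c v. D (s' c v) = s c (D v)"
    using assms(1) z unfolding complex_differentiable_on_def by blast
  obtain D' where D': "(g has_derivative D') (at z within S)" "\<forall>c v. D' (s' c v) = s c (D' v)"
    using assms(2) z unfolding complex_differentiable_on_def by blast
  show "\<exists>D. ((\<lambda>z. f z + g z) has_derivative D) (at z within S) \<and>
      (\<forall>c v. D (s' c v) = s c (D v))"
    using has_derivative_add[OF D(1) D'(1)] D(2) D'(2)
    by (intro exI[of _ "\<lambda>v. D v + D' v"]) (simp add: scale_right_distrib)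
qed

lemma bounded_linear_scale: "bounded_linear (s c)"
proof
  show "s c (v + w) = s c v + s c w" for v w
    by (rule scale_right_distrib)
  show "s c (r *\<^sub>R v) = r *\<^sub>R s c v" for r v
    by (simp flip: scale_of_real add: mult.commute)
  show "\<exists>K. \<forall>v. norm (s c v) \<le> norm v * K"
    by (intro exI[of _ "cmod c"]) (simp add: norm_scale mult.commute)
qed

lemma complex_differentiable_on_scale:
  assumes "complex_differentiable_on s' s f S"
  shows "complex_differentiable_on s' s (\<lambda>z. s c (f z)) S"
proof (rule complex_differentiable_on_compose[OF assms])
  show "complex_differentiable_on s s (s c) UNIV"
    unfolding complex_differentiable_on_def
  proof (intro ballI exI conjI allI)
    show "(s c has_derivative s c) (at z within UNIV)" for z
      by (rule bounded_linear_imp_has_derivative[OF bounded_linear_scale])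
    show "s c (s a v) = s a (s c v)" for a v
      by (simp add: mult.commute)
  qed
qed simp

lemma holomorphic_map_zero: "holomorphic_map A s S 0"
  unfolding holomorphic_map_def o_def zero_fun_def
  by (intro ballI complex_differentiable_on_zero)

lemma holomorphic_map_add:
  "\<lbrakk>holomorphic_map A s S f; holomorphic_map A s S g\<rbrakk> \<Longrightarrow> holomorphic_map A s S (f + g)"
  unfolding holomorphic_map_def o_def plus_fun_def
  by (intro ballI complex_differentiable_on_add) auto

lemma holomorphic_map_fun_scale:
  "holomorphic_map A s S f \<Longrightarrow> holomorphic_map A s S (fun_scale s c f)"
  unfolding holomorphic_map_def o_def fun_scale_def
  by (intro ballI complex_differentiable_on_scale) auto

lemma module_fun_scale: "module (fun_scale s)"
  by unfold_locales
    (auto simp: fun_scale_def fun_eq_iff scale_right_distrib scale_left_distrib)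

end

section \<open>Left translations on a complex Lie group\<close>

lemma chart_inv_coord:
  assumes "is_chart X c" "x \<in> fst c"
  shows "chart_inv c (snd c x) = x"
proof -
  have "inj_on (snd c) (fst c)"
    using assms homeomorphic_imp_injective_map openin_subset
    unfolding is_chart_def by (metis topspace_subtopology_subset)
  then show ?thesis
    using assms(2) by (simp add: chart_inv_def)
qed

lemma continuous_map_coord:
  assumes "is_chart X c"
  shows "continuous_map (subtopology X (fst c)) (top_of_set (snd c ` fst c)) (snd c)"
  using assms homeomorphic_imp_continuous_map unfolding is_chart_def by blast

text \<open>The inverse homeomorphism agrees with \<open>chart_inv c\<close> on the image of the chart.\<close>

lemma continuous_map_chart_inv:
  assumes "is_chart X c"
  shows "continuous_map (top_of_set (snd c ` fst c)) X (chart_inv c)"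
proof -
  obtain g where g: "homeomorphic_maps (subtopology X (fst c)) (top_of_set (snd c ` fst c)) (snd c) g"
    using assms unfolding is_chart_def homeomorphic_map_maps by blast
  have "topspace (subtopology X (fst c)) = fst c"
    using assms openin_subset unfolding is_chart_def by (metis topspace_subtopology_subset)
  then have "g (snd c x) = chart_inv c (snd c x)" if "x \<in> fst c" for x
    using g that chart_inv_coord[OF assms] unfolding homeomorphic_maps_def by simp
  then have "\<And>z. z \<in> topspace (top_of_set (snd c ` fst c)) \<Longrightarrow> g z = chart_inv c z"
    by auto
  moreover have "continuous_map (top_of_set (snd c ` fst c)) X g"
    using g unfolding homeomorphic_maps_def by (simp add: continuous_map_in_subtopology)
  ultimately show ?thesis
    using continuous_map_eq by blast
qed

context complex_lie_group
begin

lemma is_chart: "c \<in> A \<Longrightarrow> is_chart X c"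
  using manifold unfolding complex_manifold_def by (elim conjE) (erule (1) bspec)

lemma obtain_chart:
  assumes "x \<in> carrier \<G>"
  obtains c where "c \<in> A" "x \<in> fst c"
proof -
  have "(\<Union>c\<in>A. fst c) = carrier \<G>"
    using manifold topspace_eq unfolding complex_manifold_def by simp
  then show ?thesis
    using assms that by blast
qed

text \<open>On the domain of a chart the map is its coordinate expression after the coordinate map, and the
  domains of the charts cover the manifold.\<close>

lemma holomorphic_map_imp_continuous_map:
  assumes f: "holomorphic_map A s S f" and S: "S \<subseteq> carrier \<G>"
  shows "continuous_map (subtopology X S) euclidean f"
proof (rule pasting_lemma[where I = A and T = "\<lambda>c. fst c \<inter> S" and f = "\<lambda>c. f"])
  fix c assume c: "c \<in> A"
  show "openin (subtopology X S) (fst c \<inter> S)"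
    using is_chart[OF c] by (auto simp: is_chart_def openin_subtopology)
  have "continuous_on (snd c ` (fst c \<inter> S)) (f \<circ> chart_inv c)"
    using f c complex_differentiable_on_imp_continuous_on unfolding holomorphic_map_def by blast
  moreover have "continuous_map (subtopology X (fst c \<inter> S)) (top_of_set (snd c ` (fst c \<inter> S))) (snd c)"
    using continuous_map_from_subtopology[OF continuous_map_coord[OF is_chart[OF c]], of S]
    by (auto simp: continuous_map_in_subtopology subtopology_subtopology)
  ultimately have "continuous_map (subtopology X (fst c \<inter> S)) euclidean (f \<circ> chart_inv c \<circ> snd c)"
    using continuous_map_compose continuous_map_iff_continuous by blast
  then have "continuous_map (subtopology X (fst c \<inter> S)) euclidean f"
    by (rule continuous_map_eq) (simp add: chart_inv_coord[OF is_chart[OF c]])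
  then show "continuous_map (subtopology (subtopology X S) (fst c \<inter> S)) euclidean f"
    by (simp add: subtopology_subtopology Int_commute Int_left_commute)
next
  fix x assume "x \<in> topspace (subtopology X S)"
  then show "\<exists>c. c \<in> A \<and> x \<in> fst c \<inter> S \<and> f x = f x"
    using S obtain_chart[of x] by (metis IntI IntD2 subsetD topspace_subtopology)
qed simp

text \<open>Left translation by \<open>g\<close> is the multiplication restricted to the slice \<open>{g} \<times> \<G>\<close>, which in
  coordinates is the affine map \<open>z \<mapsto> (snd cg g, z)\<close> for a chart \<open>cg\<close> at \<open>g\<close>.\<close>

lemma complex_differentiable_on_left_translation:
  assumes g: "g \<in> carrier \<G>" and c: "c \<in> A" and c': "c' \<in> A"
  shows "complex_differentiable_on (*s) (*s) (\<lambda>z. snd c' (g \<otimes> chart_inv c z))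
    {z \<in> snd c ` fst c. g \<otimes> chart_inv c z \<in> fst c'}"
proof -
  obtain cg where cg: "cg \<in> A" "g \<in> fst cg"
    using g by (rule obtain_chart)
  have g_eq: "chart_inv cg (snd cg g) = g"
    by (rule chart_inv_coord[OF is_chart[OF cg(1)] cg(2)])
  have "complex_differentiable_on (*s) (\<lambda>a. map_prod ((*s) a) ((*s) a)) (\<lambda>z. (snd cg g, z))
      {z \<in> snd c ` fst c. g \<otimes> chart_inv c z \<in> fst c'}"
    unfolding complex_differentiable_on_def
    by (intro ballI exI[of _ "\<lambda>v. (0, v)"] conjI) (auto intro!: derivative_eq_intros)
  from complex_differentiable_on_compose[OF this holomorphic_mult[OF cg(1) c c']]
  have "complex_differentiable_on (*s) (*s)
      (\<lambda>z. snd c' (chart_inv cg (snd cg g) \<otimes> chart_inv c z))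
      {z \<in> snd c ` fst c. g \<otimes> chart_inv c z \<in> fst c'}"
    using cg(2) by (simp add: image_subset_iff g_eq)
  then show ?thesis
    by (simp only: g_eq)
qed

text \<open>Near a point \<open>x\<close> the coordinate expression of \<open>h\<close> in a chart \<open>c\<close> is that of \<open>f\<close> in a chart \<open>c'\<close>
  at \<open>g \<otimes> x\<close>, after left translation by \<open>g\<close> read in \<open>c\<close> and \<open>c'\<close>.\<close>

lemma holomorphic_map_left_translate:
  assumes f: "holomorphic_map A s S f" and S: "S \<subseteq> carrier \<G>" and g: "g \<in> carrier \<G>"
    and invariant: "\<And>x. x \<in> S \<Longrightarrow> g \<otimes> x \<in> S"
    and h: "\<And>x. x \<in> S \<Longrightarrow> h x = f (g \<otimes> x)"
  shows "holomorphic_map A s S h"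
  unfolding holomorphic_map_def
proof (intro ballI complex_differentiable_on_local)
  fix c z assume c: "c \<in> A" and z: "z \<in> snd c ` (fst c \<inter> S)"
  note inv_c = chart_inv_coord[OF is_chart[OF c]]
  from z obtain x where x: "x \<in> fst c" "x \<in> S" "z = snd c x" by blast
  then obtain c' where c': "c' \<in> A" "g \<otimes> x \<in> fst c'"
    using invariant S obtain_chart by blast
  define N where "N = {w \<in> snd c ` fst c. g \<otimes> chart_inv c w \<in> fst c'}"
  have "continuous_map (top_of_set (snd c ` fst c)) X (\<lambda>w. g \<otimes> chart_inv c w)"
    using continuous_map_compose[OF continuous_map_pairedI[OF _ continuous_map_chart_inv[OF is_chart[OF c]]]
        continuous_mult, of "\<lambda>w. g"] g
    by (simp add: o_def topspace_eq)
  from openin_continuous_map_preimage[OF this, of "fst c'"]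
  have "openin (top_of_set (snd c ` fst c)) N"
    using is_chart[OF c'(1)] by (simp add: N_def is_chart_def)
  then have "open N"
    using is_chart[OF c] openin_open_eq unfolding is_chart_def by blast
  moreover have "z \<in> N"
    using x c' inv_c by (simp add: N_def)
  moreover have "complex_differentiable_on (*s) s (h \<circ> chart_inv c) (snd c ` (fst c \<inter> S) \<inter> N)"
  proof (rule complex_differentiable_on_cong)
    have "complex_differentiable_on (*s) (*s) (\<lambda>w. snd c' (g \<otimes> chart_inv c w))
        (snd c ` (fst c \<inter> S) \<inter> N)"
      using complex_differentiable_on_left_translation[OF g c c'(1)]
      by (rule complex_differentiable_on_subset) (auto simp: N_def)
    moreover have "complex_differentiable_on (*s) s (f \<circ> chart_inv c') (snd c' ` (fst c' \<inter> S))"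
      using f c' by (simp add: holomorphic_map_def)
    moreover have "(\<lambda>w. snd c' (g \<otimes> chart_inv c w)) ` (snd c ` (fst c \<inter> S) \<inter> N)
        \<subseteq> snd c' ` (fst c' \<inter> S)"
    proof
      fix v assume "v \<in> (\<lambda>w. snd c' (g \<otimes> chart_inv c w)) ` (snd c ` (fst c \<inter> S) \<inter> N)"
      then obtain y where y: "y \<in> fst c" "y \<in> S" "snd c y \<in> N"
        "v = snd c' (g \<otimes> chart_inv c (snd c y))" by blast
      then have "g \<otimes> y \<in> fst c'"
        by (simp add: N_def inv_c)
      then show "v \<in> snd c' ` (fst c' \<inter> S)"
        using y invariant inv_c by simp
    qed
    ultimately show "complex_differentiable_on (*s) s
        (\<lambda>w. (f \<circ> chart_inv c') (snd c' (g \<otimes> chart_inv c w))) (snd c ` (fst c \<inter> S) \<inter> N)"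
      by (rule complex_differentiable_on_compose)
  next
    fix w assume w: "w \<in> snd c ` (fst c \<inter> S) \<inter> N"
    then obtain y where y: "y \<in> fst c" "y \<in> S" "snd c y \<in> N" "w = snd c y" by blast
    then have "g \<otimes> y \<in> fst c'"
      by (simp add: N_def inv_c)
    then show "(f \<circ> chart_inv c') (snd c' (g \<otimes> chart_inv c w)) = (h \<circ> chart_inv c) w"
      using y h inv_c chart_inv_coord[OF is_chart[OF c'(1)]] by simp
  qed
  ultimately show "\<exists>N. open N \<and> z \<in> N \<and>
      complex_differentiable_on (*s) s (h \<circ> chart_inv c) (snd c ` (fst c \<inter> S) \<inter> N)"
    by blast
qed

end

section \<open>Translation of equivariant holomorphic maps\<close>

locale equivariant_translation =
  complex_lie_group \<G> X A + fin_dim_complex_normed_space s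
  for \<G> :: "('a, 'b) monoid_scheme" (structure)
    and X :: "'a topology" and A :: "('a, 'm::finite) chart set"
    and s :: "complex \<Rightarrow> 'v::real_normed_vector \<Rightarrow> 'v" +
  fixes H Q :: "'a set" and \<rho> :: "'a \<Rightarrow> 'v \<Rightarrow> 'v"
  assumes subgroup_H: "subgroup H \<G>"
    and Q_subset: "Q \<subseteq> carrier \<G>"
    and \<rho>_GL: "\<And>q. q \<in> Q \<Longrightarrow> \<rho> q \<in> carrier (GL s UNIV)"
begin

abbreviation \<Omega> where "\<Omega> \<equiv> H <#> Q"
abbreviation \<V> where "\<V> \<equiv> equivariant_holomorphic_maps \<G> A s \<Omega> Q \<rho>"
abbreviation r where "r \<equiv> translation_rep \<G> \<Omega> \<V>"

lemma H_subset: "H \<subseteq> carrier \<G>"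
  using subgroup_H by (rule subgroup.subset)

lemma \<Omega>_subset: "\<Omega> \<subseteq> carrier \<G>"
  using H_subset Q_subset by (rule set_mult_closed)

lemma translate_\<Omega>:
  assumes "g \<in> H" "x \<in> \<Omega>"
  shows "g \<otimes> x \<in> \<Omega>"
proof -
  obtain h q where hq: "h \<in> H" "q \<in> Q" "x = h \<otimes> q"
    using assms(2) by (auto simp: set_mult_def)
  then have "g \<otimes> x = (g \<otimes> h) \<otimes> q"
    using assms(1) H_subset Q_subset by (simp add: m_assoc subsetD)
  then show ?thesis
    using hq subgroup.m_closed[OF subgroup_H assms(1)] by (auto simp: set_mult_def)
qed

lemma inv_in_H: "g \<in> H \<Longrightarrow> inv g \<in> H"
  using subgroup_H by (rule subgroup.m_inv_closed)

lemma translate_\<Omega>_iff: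
  assumes "g \<in> H" "x \<in> carrier \<G>"
  shows "g \<otimes> x \<in> \<Omega> \<longleftrightarrow> x \<in> \<Omega>"
proof
  assume "g \<otimes> x \<in> \<Omega>"
  then have "inv g \<otimes> (g \<otimes> x) \<in> \<Omega>"
    using assms inv_in_H translate_\<Omega> by blast
  then show "x \<in> \<Omega>"
    using assms H_subset by (simp add: subsetD flip: m_assoc)
qed (rule translate_\<Omega>[OF assms(1)])

lemma inverse_\<rho>_linear:
  assumes "q \<in> Q"
  shows "inv_into UNIV (\<rho> q) (v + w) = inv_into UNIV (\<rho> q) v + inv_into UNIV (\<rho> q) w"
    and "inv_into UNIV (\<rho> q) (s c v) = s c (inv_into UNIV (\<rho> q) v)"
proof -
  have \<rho>: "bij (\<rho> q)" "\<And>v w. \<rho> q (v + w) = \<rho> q v + \<rho> q w" "\<And>c v. \<rho> q (s c v) = s c (\<rho> q v)"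
    using \<rho>_GL[OF assms] by (simp_all add: GL_def Bij_def linear_on_def)
  have cancel: "inv_into UNIV (\<rho> q) (\<rho> q v) = v" "\<rho> q (inv_into UNIV (\<rho> q) v) = v" for v
    using \<rho>(1) by (simp_all add: bij_is_inj bij_is_surj surj_f_inv_f)
  have "v + w = \<rho> q (inv_into UNIV (\<rho> q) v + inv_into UNIV (\<rho> q) w)"
    by (simp add: \<rho>(2) cancel(2))
  then show "inv_into UNIV (\<rho> q) (v + w) = inv_into UNIV (\<rho> q) v + inv_into UNIV (\<rho> q) w"
    by (simp only: cancel(1))
  have "s c v = \<rho> q (s c (inv_into UNIV (\<rho> q) v))"
    by (simp add: \<rho>(3) cancel(2))
  then show "inv_into UNIV (\<rho> q) (s c v) = s c (inv_into UNIV (\<rho> q) v)"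
    by (simp only: cancel(1))
qed

lemma inverse_\<rho>_zero: "q \<in> Q \<Longrightarrow> inv_into UNIV (\<rho> q) 0 = 0"
  using inverse_\<rho>_linear(2)[of q 0 0] by simp

text \<open>Each \<open>\<rho> q\<close> is an invertible linear map, hence so is its inverse, and the equivariance
  condition under \<open>Q\<close> cuts out a linear subspace.\<close>

lemma subspace_\<V>: "module.subspace (fun_scale s) \<V>"
  unfolding module.subspace_def[OF module_fun_scale] equivariant_holomorphic_maps_def
  by (auto simp: holomorphic_map_zero holomorphic_map_add holomorphic_map_fun_scale
      inverse_\<rho>_linear inverse_\<rho>_zero fun_scale_def holomorphic_map_fun_scale[unfolded fun_scale_def])

lemma vanishes_outside_\<Omega>: "\<lbrakk>\<psi> \<in> \<V>; x \<notin> \<Omega>\<rbrakk> \<Longrightarrow> \<psi> x = 0"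
  by (simp add: equivariant_holomorphic_maps_def)

text \<open>Extension by zero is compatible with translation, since \<open>\<Omega>\<close> is stable under \<open>H\<close>: a point outside
  \<open>\<Omega>\<close> is moved to a point where \<open>\<psi>\<close> vanishes as well. The formula on the whole group gives the
  equivariance of translates at \<open>x \<otimes> q\<close> without a distinction whether that point lies in \<open>\<Omega>\<close>.\<close>

lemma translation_apply:
  assumes "g \<in> H" "\<psi> \<in> \<V>" "x \<in> carrier \<G>"
  shows "r g \<psi> x = \<psi> (inv g \<otimes> x)"
  using assms translate_\<Omega>_iff[OF inv_in_H] vanishes_outside_\<Omega>
  by (simp add: translation_rep_def)

lemma translation_outside: "\<lbrakk>\<psi> \<in> \<V>; x \<notin> \<Omega>\<rbrakk> \<Longrightarrow> r g \<psi> x = 0"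
  by (simp add: translation_rep_def)

text \<open>Translation acts on the left and equivariance concerns the right, so the two commute by
  associativity.\<close>

lemma translation_in_\<V>:
  assumes g: "g \<in> H" and \<psi>: "\<psi> \<in> \<V>"
  shows "r g \<psi> \<in> \<V>"
proof -
  have ig: "inv g \<in> H" "inv g \<in> carrier \<G>"
    using g inv_in_H H_subset by auto
  have "holomorphic_map A s \<Omega> \<psi>"
    using \<psi> by (simp add: equivariant_holomorphic_maps_def)
  then have "holomorphic_map A s \<Omega> (r g \<psi>)"
    using \<Omega>_subset ig(2)
    by (rule holomorphic_map_left_translate)
      (use translate_\<Omega> translation_apply g \<psi> ig \<Omega>_subset in auto)
  moreover have "r g \<psi> (x \<otimes> q) = inv_into UNIV (\<rho> q) (r g \<psi> x)" if x: "x \<in> \<Omega>" and q: "q \<in> Q" for x q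
  proof -
    have xq: "x \<in> carrier \<G>" "q \<in> carrier \<G>"
      using x q \<Omega>_subset Q_subset by auto
    have "r g \<psi> (x \<otimes> q) = \<psi> ((inv g \<otimes> x) \<otimes> q)"
      using g \<psi> xq ig by (simp add: translation_apply m_assoc)
    also have "\<dots> = inv_into UNIV (\<rho> q) (\<psi> (inv g \<otimes> x))"
      using \<psi> q translate_\<Omega>[OF ig(1) x] by (simp add: equivariant_holomorphic_maps_def)
    finally show ?thesis
      using g \<psi> xq by (simp add: translation_apply)
  qed
  ultimately show ?thesis
    using translation_outside[OF \<psi>] unfolding equivariant_holomorphic_maps_def by blast
qed

lemma translation_mult:
  assumes g: "g \<in> H" and h: "h \<in> H" and \<psi>: "\<psi> \<in> \<V>"
  shows "r (g \<otimes> h) \<psi> = r g (r h \<psi>)"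
proof
  fix x
  show "r (g \<otimes> h) \<psi> x = r g (r h \<psi>) x"
  proof (cases "x \<in> \<Omega>")
    case True
    then have x: "x \<in> carrier \<G>" and gh: "g \<in> carrier \<G>" "h \<in> carrier \<G>" "g \<otimes> h \<in> H"
      using \<Omega>_subset g h H_subset subgroup.m_closed[OF subgroup_H] by auto
    then show ?thesis
      using g h \<psi> translation_in_\<V> by (simp add: translation_apply inv_mult_group m_assoc)
  qed (use translation_outside translation_in_\<V> h \<psi> in simp)
qed

lemma translation_one:
  assumes "\<psi> \<in> \<V>"
  shows "r \<one> \<psi> = \<psi>"
proof
  fix x
  show "r \<one> \<psi> x = \<psi> x"
    using assms \<Omega>_subset subgroup.one_closed[OF subgroup_H]
    by (cases "x \<in> \<Omega>") (auto simp: translation_apply translation_outside vanishes_outside_\<Omega> subset_iff)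
qed

lemma translation_in_GL:
  assumes g: "g \<in> H"
  shows "r g \<in> carrier (GL (fun_scale s) \<V>)"
proof -
  have gG: "g \<in> carrier \<G>"
    using g H_subset by blast
  have "bij_betw (r g) \<V> \<V>"
  proof (rule bij_betwI)
    show "r g \<in> \<V> \<rightarrow> \<V>" "r (inv g) \<in> \<V> \<rightarrow> \<V>"
      using g inv_in_H translation_in_\<V> by auto
    show "r (inv g) (r g \<psi>) = \<psi>" "r g (r (inv g) \<psi>) = \<psi>" if "\<psi> \<in> \<V>" for \<psi>
      using translation_mult[OF _ _ that, symmetric] translation_one[OF that] g gG inv_in_H
      by simp_all
  qed
  moreover have "linear_on (fun_scale s) \<V> (r g)"
    using module.subspace_add[OF module_fun_scale subspace_\<V>]
      module.subspace_scale[OF module_fun_scale subspace_\<V>]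
    by (auto simp: linear_on_def translation_rep_def fun_scale_def fun_eq_iff)
  moreover have "r g \<in> extensional \<V>"
    by (simp add: translation_rep_def)
  ultimately show ?thesis
    by (simp add: GL_def Bij_def)
qed

lemma translation_hom: "r \<in> hom (\<G>\<lparr>carrier := H\<rparr>) (GL (fun_scale s) \<V>)"
proof (rule homI)
  fix g h assume "g \<in> carrier (\<G>\<lparr>carrier := H\<rparr>)" "h \<in> carrier (\<G>\<lparr>carrier := H\<rparr>)"
  then have gh: "g \<in> H" "h \<in> H" by simp_all
  then have "r (g \<otimes> h) = compose \<V> (r g) (r h)"
    by (intro extensionalityI[of _ \<V>]) (simp_all add: translation_mult compose_eq, simp add: translation_rep_def)
  then show "r (g \<otimes>\<^bsub>\<G>\<lparr>carrier := H\<rparr>\<^esub> h) = r g \<otimes>\<^bsub>GL (fun_scale s) \<V>\<^esub> r h"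
    using translation_in_GL[OF gh(1)] translation_in_GL[OF gh(2)]
    by (simp add: GL_def BijGroup_def)
qed (use translation_in_GL in simp)

lemma continuous_map_left_action:
  "continuous_map (prod_topology (subtopology X H) (subtopology X \<Omega>)) (subtopology X \<Omega>)
    (\<lambda>(g, x). inv g \<otimes> x)"
proof -
  let ?P = "prod_topology (subtopology X H) (subtopology X \<Omega>)"
  have "continuous_map ?P X fst" "continuous_map ?P X snd"
    using continuous_map_fst[of "subtopology X H" "subtopology X \<Omega>"]
      continuous_map_snd[of "subtopology X H" "subtopology X \<Omega>"]
    by (simp_all add: continuous_map_in_subtopology)
  then have "continuous_map ?P (prod_topology X X) (\<lambda>p. (inv (fst p), snd p))"
    using continuous_map_compose[OF _ continuous_inv]
    by (intro continuous_map_pairedI) (simp_all add: o_def)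
  from continuous_map_compose[OF this continuous_mult]
  have "continuous_map ?P X (\<lambda>(g, x). inv g \<otimes> x)"
    by (simp add: o_def case_prod_unfold)
  then show ?thesis
    using translate_\<Omega> inv_in_H by (auto simp: continuous_map_in_subtopology)
qed

end

section \<open>The representation on equivariant holomorphic maps\<close>

theorem proposition11p2p8:
  fixes GC :: "('a, 'b) monoid_scheme"
    and X :: "'a topology"
    and A :: "('a, 'm::finite) chart set"
    and G L Q \<Omega> :: "'a set"
    and T :: "complex ^ 'm"
    and s :: "complex \<Rightarrow> 'v::real_normed_vector \<Rightarrow> 'v"
    and \<rho> :: "'a \<Rightarrow> 'v \<Rightarrow> 'v"
    and O' E :: "nat \<Rightarrow> 'a set"
    and \<V> :: "('a \<Rightarrow> 'v) set"
  assumes "complex_semisimple_lie_group GC X A"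
    and "connected_space X"
    and "subgroup G GC" and "closedin X G" and "connectedin X G"
    and "real_form GC A (lie_algebra_of GC X A G)"
    and "elliptic GC A (lie_algebra_of GC X A G) T" and "T \<noteq> 0"
    and "L = centralizer_of GC A G T"
    and "Q = Q_minus GC A T"
    and "\<Omega> = G <#>\<^bsub>GC\<^esub> Q"
    and "fin_dim_complex_normed_space s"
    and "holomorphic_GL_hom GC A s Q \<rho>"
    and "\<V> = equivariant_holomorphic_maps GC A s \<Omega> Q \<rho>"
    and "\<And>n. openin (subtopology X \<Omega>) (O' n)" and "\<And>n. O' n \<noteq> {}"
    and "(\<Union>n. O' n) = \<Omega>"
    and "\<And>n. E n = (subtopology X \<Omega>) closure_of (O' n)"
    and "\<And>n. compactin (subtopology X \<Omega>) (E n)"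
  shows "continuous_representation (GC\<lparr>carrier := G\<rparr>) (subtopology X G)
           (fun_scale s) \<V> (frechet_metric \<V> E) (translation_rep GC \<Omega> \<V>)"
proof -
  interpret complex_semisimple_lie_group GC X A by fact
  interpret fin_dim_complex_normed_space s by fact
  have Q: "Q \<subseteq> carrier GC"
    using assms(10) by (auto simp: Q_minus_def Let_def)
  have \<rho>: "\<rho> q \<in> carrier (GL s UNIV)" if "q \<in> Q" for q
    using assms(13) that by (auto simp: holomorphic_GL_hom_def hom_def)
  interpret R: equivariant_translation GC X A s G Q \<rho>
    by (intro equivariant_translation.intro equivariant_translation_axioms.intro
        complex_lie_group_axioms fin_dim_complex_normed_space_axioms assms(3) Q \<rho>)
  have \<Omega>: "topspace (subtopology X \<Omega>) = \<Omega>"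
    using R.\<Omega>_subset assms(11) topspace_eq by auto
  have G: "topspace (subtopology X G) = G"
    using R.H_subset topspace_eq by auto
  interpret F: functions_on_compact_cover "subtopology X \<Omega>" O' E \<V>
  proof
    show "O' n \<subseteq> E n" for n
      using assms(15)[of n] assms(18)[of n] closure_of_subset openin_subset by metis
    show "(\<Union>n. O' n) = topspace (subtopology X \<Omega>)"
      using assms(17) \<Omega> by simp
    show "continuous_map (subtopology X \<Omega>) euclidean \<psi>" if "\<psi> \<in> \<V>" for \<psi>
    proof (rule holomorphic_map_imp_continuous_map)
      show "holomorphic_map A s \<Omega> \<psi>"
        using that assms(14) by (simp add: equivariant_holomorphic_maps_def)
      show "\<Omega> \<subseteq> carrier GC"
        using R.\<Omega>_subset assms(11) by simp
    qed
    show "\<psi> x = 0" if "\<psi> \<in> \<V>" "x \<notin> topspace (subtopology X \<Omega>)" for \<psi> x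
      using R.vanishes_outside_\<Omega>[of \<psi> x] that(1) that(2)[unfolded \<Omega>] assms(11,14)
      by simp
  qed (fact assms)+
  have "continuous_map (prod_topology (subtopology X G) F.mtopology) F.mtopology
      (\<lambda>(g, \<psi>). translation_rep GC \<Omega> \<V> g \<psi>)"
  proof (rule F.continuous_map_translation)
    show "continuous_map (prod_topology (subtopology X G) (subtopology X \<Omega>)) (subtopology X \<Omega>)
        (\<lambda>(g, x). inv\<^bsub>GC\<^esub> g \<otimes>\<^bsub>GC\<^esub> x)"
      using R.continuous_map_left_action assms(11) by simp
    show "translation_rep GC \<Omega> \<V> g \<psi> \<in> \<V>"
      if "g \<in> topspace (subtopology X G)" "\<psi> \<in> \<V>" for g \<psi>
      using R.translation_in_\<V> that G assms(11,14) by simp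
    show "translation_rep GC \<Omega> \<V> g \<psi> x = \<psi> (case (g, x) of (g, x) \<Rightarrow> inv\<^bsub>GC\<^esub> g \<otimes>\<^bsub>GC\<^esub> x)"
      if "g \<in> topspace (subtopology X G)" "\<psi> \<in> \<V>" "x \<in> topspace (subtopology X \<Omega>)" for g \<psi> x
      using that \<Omega> by (simp add: translation_rep_def)
  qed
  then show ?thesis
    using R.subspace_\<V> R.translation_hom F.Metric_space_axioms
    unfolding continuous_representation_def assms(11,14) by blast
qed

end
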